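(* Let $S\subseteq\mathbb{C}$ be a complex semidomain that is bi-UFS and is not a UFD. If the set $\mathcal{A}^+(S)$ of additive atoms of $S$ is finite, then $S$ is isomorphic (as a semiring, i.e. via a bijection preserving addition, multiplication, $0$ and $1$) to a positive semidomain.
   Context: A complex semidomain is a subset $S\subseteq\mathbb{C}$ containing $0$ and $1$ and closed under the usual addition and multiplication; put $S^*=S\setminus\{0\}$. A positive semidomain is such a subset contained in $\mathbb{R}_{\ge 0}$. All monoids are commutative and cancellative. A nonunit $a$ of a monoid $M$ is an atom if $a=xy$ with $x,y\in M$ forces $x$ or $y$ to be a unit. A monoid is a unique factorization monoid (UFM) if every nonunit factors into finitely many atoms, uniquely up to order and multiplication by units (equivalently, after passing to the quotient by the group of units). $S$ is bi-UFS if both $(S,+)$ and $(S^*,\cdot)$ are UFMs. $\mathcal{A}^+(S)$ denotes the set of atoms of $(S,+)$. "$S$ is a UFD" means that $S$ is an integral domain (in particular a ring, closed under negation) that is a unique factorization domain. *)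

theory Defs
  imports
    Complex_Main
    "HOL-Library.Nonpos_Ints"
    "HOL-Algebra.Ring_Divisibility"
begin

definition complex_semidomain :: "complex set \<Rightarrow> bool" where
  "complex_semidomain S \<longleftrightarrow>
     0 \<in> S \<and> 1 \<in> S \<and> (\<forall>x\<in>S. \<forall>y\<in>S. x + y \<in> S) \<and> (\<forall>x\<in>S. \<forall>y\<in>S. x * y \<in> S)"

definition positive_semidomain :: "complex set \<Rightarrow> bool" where
  "positive_semidomain S \<longleftrightarrow> complex_semidomain S \<and> S \<subseteq> \<real>\<^sub>\<ge>\<^sub>0"

text \<open>The type of ring records only supplies the operations; it does not assert that the carrier is
  closed under negation. For the record below, \<open>add_monoid\<close> is the monoid (S, +) and \<open>mult_of\<close>
  is the monoid of nonzero elements of S under multiplication.\<close>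

definition semiring_on :: "complex set \<Rightarrow> complex ring" where
  "semiring_on S = \<lparr>carrier = S, mult = (*), one = 1, zero = 0, add = (+)\<rparr>"

definition additive_atoms :: "complex set \<Rightarrow> complex set" where
  "additive_atoms S = {a \<in> S. Divisibility.irreducible (add_monoid (semiring_on S)) a}"

definition bi_UFS :: "complex set \<Rightarrow> bool" where
  "bi_UFS S \<longleftrightarrow>
     factorial_monoid (add_monoid (semiring_on S)) \<and> factorial_monoid (mult_of (semiring_on S))"

definition is_UFD :: "complex set \<Rightarrow> bool" where
  "is_UFD S \<longleftrightarrow> factorial_domain (semiring_on S)"

text \<open>Ring homomorphisms in the library are not required to map zero to zero, because for rings
  this is automatic; for semirings it is stated separately.\<close>

definition semiring_isomorphic :: "complex set \<Rightarrow> complex set \<Rightarrow> bool" where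
  "semiring_isomorphic S T \<longleftrightarrow> (\<exists>h \<in> ring_iso (semiring_on S) (semiring_on T). h 0 = 0)"

lemma semiring_semiring_on:
  assumes "complex_semidomain S"
  shows "semiring (semiring_on S)"
  using assms
  by unfold_locales (auto simp: complex_semidomain_def semiring_on_def algebra_simps)

text \<open>Irreducibility is defined in the library through proper divisors; in a cancellative monoid
  this is the usual notion of an atom.\<close>

lemma (in comm_monoid_cancel) irreducible_iff_atom:
  assumes a: "a \<in> carrier G"
  shows "Divisibility.irreducible G a \<longleftrightarrow>
    a \<notin> Units G \<and> (\<forall>x\<in>carrier G. \<forall>y\<in>carrier G. a = x \<otimes> y \<longrightarrow> x \<in> Units G \<or> y \<in> Units G)"
proof safe
  fix x y assume irr: "Divisibility.irreducible G (x \<otimes> y)"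
    and xy: "x \<in> carrier G" "y \<in> carrier G" and ny: "y \<notin> Units G"
  show "x \<in> Units G"
  proof (rule ccontr)
    assume nx: "x \<notin> Units G"
    have "x divides x \<otimes> y" using xy by (auto simp: factor_def)
    moreover have "\<not> x \<otimes> y divides x"
    proof
      assume "x \<otimes> y divides x"
      then obtain c where c: "c \<in> carrier G" "x = x \<otimes> y \<otimes> c"
        by (auto simp: factor_def)
      then have "x \<otimes> (y \<otimes> c) = x \<otimes> \<one>" using xy by (metis m_assoc r_one)
      then have "y \<otimes> c = \<one>"
        by (rule l_cancel) (use xy c(1) in simp_all)
      then have "y \<in> Units G"
        using xy c(1) by (metis (no_types, lifting) m_comm unit_factor Units_one_closed)
      then show False using ny by simp
    qed
    ultimately have "properfactor G x (x \<otimes> y)" by (simp add: properfactor_def)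
    then show False using irr xy nx by (simp add: Divisibility.irreducible_def)
  qed
next
  assume "Divisibility.irreducible G a" "a \<in> Units G"
  then show False by (simp add: Divisibility.irreducible_def)
next
  assume na: "a \<notin> Units G" and
    at: "\<forall>x\<in>carrier G. \<forall>y\<in>carrier G. a = x \<otimes> y \<longrightarrow> x \<in> Units G \<or> y \<in> Units G"
  show "Divisibility.irreducible G a"
  proof (rule irreducibleI[OF na])
    fix b assume b: "b \<in> carrier G" and pf: "properfactor G b a"
    then obtain c where c: "c \<in> carrier G" "a = b \<otimes> c"
      by (auto simp: properfactor_def factor_def)
    have "c \<notin> Units G"
    proof
      assume cu: "c \<in> Units G"
      then have "b = a \<otimes> inv c"
        using b c by (simp add: m_assoc)
      then have "a divides b" using cu by (auto simp: factor_def)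
      then show False using pf by (simp add: properfactor_def)
    qed
    then show "b \<in> Units G" using at b c by blast
  qed
qed

end

theory Submission
  imports Defs
begin

text \<open>
  If a nonzero \<open>u\<close> and \<open>- u\<close> both lie in \<open>S\<close>, then every translate \<open>a + n u\<close> of an additive atom
  is again an atom, so finitely many atoms means none at all; then every element of \<open>S\<close> is an
  additive unit, \<open>S\<close> is a ring, and its multiplicative factoriality makes it a UFD. Otherwise
  \<open>S\<close> is pointed (\<open>S \<inter> - S = {0}\<close>) and additively generated by the finite set \<open>A\<close> of its atoms,
  and it remains to find an injective semiring homomorphism from \<open>S\<close> to the nonnegative reals.

  In matrix language such a homomorphism is a common Perron eigenvector of the commuting
  nonnegative matrices by which \<open>S\<close> acts on itself. It is obtained here from orders instead
  of a fixed point theorem. By Zorn's lemma there is a maximal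
  pointed cone \<open>M\<close> that contains \<open>S\<close> and is stable under addition and under multiplication by
  \<open>S\<close>. Maximality makes it total (\<open>M \<union> - M = \<complex>\<close>, lemma \<open>total_cone_exists\<close>), so
  \<open>x \<le> y \<longleftrightarrow> y - x \<in> M\<close> is a total group order for which multiplication by elements of \<open>S\<close> is
  monotone. The sum \<open>s\<close> of the generators is an order unit: each element of \<open>S\<close> is at most a
  multiple of \<open>s\<close>. Comparing \<open>x\<close> with rational multiples of \<open>s\<close> defines a real number
  \<open>ratio x\<close>, which is additive in \<open>x\<close>. For \<open>b \<in> S\<close>, multiplying \<open>q s \<le> x\<close> by \<open>b\<close> gives
  \<open>q b s \<le> b x\<close>, whence \<open>ratio (b x) = ratio x * ratio (b s)\<close> (lemma \<open>ratio_mult\<close>). Therefore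
  \<open>h x = ratio x / ratio 1\<close> is multiplicative.

  It is injective because the rational span of \<open>A\<close> has finite dimension: if \<open>h\<close> identifies
  \<open>p\<close> and \<open>q\<close> with \<open>x = p - q \<noteq> 0\<close>, then \<open>ratio\<close> vanishes on \<open>x A\<close>, and \<open>x A\<close> spans the same space as
  \<open>A\<close>, which contains \<open>s\<close>; but \<open>ratio s = 1\<close>.
\<close>

section \<open>Extending a pointed semidomain to a total order\<close>

definition pointed_cone_over :: "complex set \<Rightarrow> complex set \<Rightarrow> bool" where
  "pointed_cone_over S M \<longleftrightarrow>
     S \<subseteq> M \<and> (\<forall>x\<in>M. \<forall>y\<in>M. x + y \<in> M) \<and> (\<forall>b\<in>S. \<forall>x\<in>M. b * x \<in> M) \<and>
     (\<forall>x\<in>M. - x \<in> M \<longrightarrow> x = 0)"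

lemma pointed_cone_over_Union_chain:
  assumes "\<C> \<noteq> {}" and "subset.chain (Collect (pointed_cone_over S)) \<C>"
  shows "pointed_cone_over S (\<Union>\<C>)"
proof -
  have cone: "pointed_cone_over S X" if "X \<in> \<C>" for X
    using assms(2) that by (auto simp: subset.chain_def)
  have common: "\<exists>X\<in>\<C>. x \<in> X \<and> y \<in> X" if xy: "x \<in> \<Union>\<C>" "y \<in> \<Union>\<C>" for x y
  proof -
    obtain X Y where XY: "X \<in> \<C>" "x \<in> X" "Y \<in> \<C>" "y \<in> Y" using xy by blast
    then have "X \<subseteq> Y \<or> Y \<subseteq> X"
      using assms(2) by (meson subset_chain_def)
    then show ?thesis using XY by blast
  qed
  show ?thesis
    unfolding pointed_cone_over_def
  proof (intro conjI ballI impI)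
    show "S \<subseteq> \<Union>\<C>"
      using assms(1) cone unfolding pointed_cone_over_def by blast
    show "x + y \<in> \<Union>\<C>" if "x \<in> \<Union>\<C>" "y \<in> \<Union>\<C>" for x y
      using common[OF that] cone unfolding pointed_cone_over_def by blast
    show "b * x \<in> \<Union>\<C>" if "b \<in> S" "x \<in> \<Union>\<C>" for b x
      using that cone unfolding pointed_cone_over_def by blast
    show "x = 0" if "x \<in> \<Union>\<C>" "- x \<in> \<Union>\<C>" for x
      using common[OF that] cone unfolding pointed_cone_over_def by blast
  qed
qed

text \<open>
  If \<open>m + b x\<close> and \<open>m' + b' x\<close> are opposite, then \<open>- (b + b') x = m + m'\<close> lies in \<open>M\<close>, so \<open>b + b' = 0\<close>,
  and pointedness kills \<open>b\<close> and then \<open>m\<close>. Hence the only obstruction to adjoining \<open>x\<close> is a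
  nonzero \<open>b \<in> S\<close> with \<open>- b x \<in> M\<close>.
\<close>

lemma pointed_cone_over_adjoin:
  assumes S: "complex_semidomain S" and M: "pointed_cone_over S M"
    and x: "\<And>b. b \<in> S \<Longrightarrow> b \<noteq> 0 \<Longrightarrow> - (b * x) \<notin> M"
  shows "pointed_cone_over S {m + b * x |m b. m \<in> M \<and> b \<in> S}" (is "pointed_cone_over S ?N")
  unfolding pointed_cone_over_def
proof (intro conjI ballI impI)
  have add: "m + m' \<in> M" if "m \<in> M" "m' \<in> M" for m m'
    using M that by (auto simp: pointed_cone_over_def)
  have mult: "b * m \<in> M" if "b \<in> S" "m \<in> M" for b m
    using M that by (auto simp: pointed_cone_over_def)
  have Sadd: "b + c \<in> S" and Smult: "b * c \<in> S" if "b \<in> S" "c \<in> S" for b c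
    using S that by (auto simp: complex_semidomain_def)
  have S0: "0 \<in> S" using S by (auto simp: complex_semidomain_def)
  have SM: "S \<subseteq> M" using M by (simp add: pointed_cone_over_def)
  show "S \<subseteq> ?N"
    using SM S0 by force
  show "u + v \<in> ?N" if uv: "u \<in> ?N" "v \<in> ?N" for u v
  proof -
    obtain m b m' b' where "u = m + b * x" "v = m' + b' * x" "m \<in> M" "m' \<in> M" "b \<in> S" "b' \<in> S"
      using uv by blast
    then have "u + v = (m + m') + (b + b') * x" "m + m' \<in> M" "b + b' \<in> S"
      by (auto simp: algebra_simps add Sadd)
    then show ?thesis by blast
  qed
  show "c * u \<in> ?N" if cu: "c \<in> S" "u \<in> ?N" for c u
  proof -
    obtain m b where "u = m + b * x" "m \<in> M" "b \<in> S" using cu by blast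
    then have "c * u = c * m + (c * b) * x" "c * m \<in> M" "c * b \<in> S"
      using cu(1) by (auto simp: algebra_simps mult Smult)
    then show ?thesis by blast
  qed
  show "u = 0" if u: "u \<in> ?N" "- u \<in> ?N" for u
  proof -
    obtain m b m' b' where eq: "u = m + b * x" "- u = m' + b' * x"
      and mem: "m \<in> M" "m' \<in> M" "b \<in> S" "b' \<in> S"
      using u by blast
    have "u + (- u) = (m + m') + (b + b') * x"
      unfolding eq(2) unfolding eq(1) by (simp add: algebra_simps)
    then have "- ((b + b') * x) = m + m'"
      by (metis add.commute add.right_inverse add_eq_0_iff)
    then have "- ((b + b') * x) \<in> M"
      using add mem by simp
    then have bb: "b + b' = 0"
      using x[of "b + b'"] Sadd mem by blast
    then have "b' = - b" by (simp add: add_eq_0_iff)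
    then have "b = 0"
      using M mem SM by (auto simp: pointed_cone_over_def)
    then show ?thesis
      using M eq mem bb by (auto simp: pointed_cone_over_def)
  qed
qed

text \<open>
  If neither \<open>x\<close> nor \<open>- x\<close> can be adjoined to a maximal cone \<open>M\<close>, there are nonzero \<open>b, c \<in> S\<close> with
  \<open>- b x \<in> M\<close> and \<open>c x \<in> M\<close>. Multiplying by \<open>c\<close> and \<open>b\<close> puts both \<open>b c x\<close> and its negative into \<open>M\<close>,
  which forces \<open>x = 0\<close>.
\<close>

lemma total_cone_exists:
  assumes S: "complex_semidomain S" and pointed: "\<And>x. x \<in> S \<Longrightarrow> - x \<in> S \<Longrightarrow> x = 0"
  obtains M where "pointed_cone_over S M" "\<And>x. x \<in> M \<or> - x \<in> M"
proof -
  have "pointed_cone_over S S"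
    using S pointed by (auto simp: pointed_cone_over_def complex_semidomain_def)
  then have "\<exists>M\<in>Collect (pointed_cone_over S). \<forall>X\<in>Collect (pointed_cone_over S). M \<subseteq> X \<longrightarrow> X = M"
    by (intro subset_Zorn_nonempty) (auto intro: pointed_cone_over_Union_chain)
  then obtain M where M: "pointed_cone_over S M"
    and max: "\<And>X. pointed_cone_over S X \<Longrightarrow> M \<subseteq> X \<Longrightarrow> X = M"
    by auto
  have S0: "0 \<in> S" and S1: "1 \<in> S" using S by (auto simp: complex_semidomain_def)
  have M0: "0 \<in> M" using M S0 by (auto simp: pointed_cone_over_def)
  have witness: "\<exists>b\<in>S. b \<noteq> 0 \<and> - (b * x) \<in> M" if x: "x \<notin> M" for x
  proof (rule ccontr)
    assume "\<not> ?thesis"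
    then have "pointed_cone_over S {m + b * x |m b. m \<in> M \<and> b \<in> S}" (is "pointed_cone_over S ?N")
      by (intro pointed_cone_over_adjoin S M) auto
    moreover have "M \<subseteq> ?N" using S0 by force
    ultimately have "?N = M" by (rule max)
    moreover have "x \<in> ?N" using S1 M0 by force
    ultimately show False using x by simp
  qed
  have "x \<in> M \<or> - x \<in> M" for x
  proof (rule ccontr)
    assume "\<not> ?thesis"
    then have nx: "x \<notin> M" "- x \<notin> M" by auto
    obtain b where b: "b \<in> S" "b \<noteq> 0" "- (b * x) \<in> M" using witness[OF nx(1)] by blast
    obtain c where c: "c \<in> S" "c \<noteq> 0" "c * x \<in> M" using witness[OF nx(2)] by auto
    have "c * (- (b * x)) \<in> M" "b * (c * x) \<in> M"
      using M b c unfolding pointed_cone_over_def by blast+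
    then have "b * (c * x) \<in> M" "- (b * (c * x)) \<in> M"
      by (simp_all add: algebra_simps)
    then have "b * (c * x) = 0"
      using M unfolding pointed_cone_over_def by blast
    then show False using b c nx M0 by auto
  qed
  with M show thesis using that by blast
qed

section \<open>The real number measured by an order unit\<close>

locale total_cone =
  fixes S M :: "complex set" and s :: complex
  assumes semidomain: "complex_semidomain S"
    and cone: "pointed_cone_over S M"
    and total: "x \<in> M \<or> - x \<in> M"
    and unit_in: "s \<in> S"
    and unit_nz: "s \<noteq> 0"
begin

lemma M_add: "x \<in> M \<Longrightarrow> y \<in> M \<Longrightarrow> x + y \<in> M"
  and M_mult: "b \<in> S \<Longrightarrow> x \<in> M \<Longrightarrow> b * x \<in> M"
  and M_pointed: "x \<in> M \<Longrightarrow> - x \<in> M \<Longrightarrow> x = 0"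
  and S_in_M: "b \<in> S \<Longrightarrow> b \<in> M"
  using cone by (auto simp: pointed_cone_over_def)

lemma S_closed: "0 \<in> S" "1 \<in> S" "x \<in> S \<Longrightarrow> y \<in> S \<Longrightarrow> x + y \<in> S" "x \<in> S \<Longrightarrow> y \<in> S \<Longrightarrow> x * y \<in> S"
  using semidomain by (auto simp: complex_semidomain_def)

lemma M_of_nat_mult: "x \<in> M \<Longrightarrow> of_nat n * x \<in> M"
proof (induction n)
  case 0
  then show ?case using S_in_M S_closed by simp
next
  case (Suc n)
  then show ?case using M_add by (simp add: distrib_right)
qed

text \<open>
  Totality makes the cone divisible: otherwise \<open>- x\<close> would lie in \<open>M\<close>, and \<open>n x\<close> would lie in \<open>M\<close>
  together with its negative. This gives rational scalars.
\<close>

lemma M_of_nat_cancel: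
  assumes "of_nat n * x \<in> M" and "n > 0"
  shows "x \<in> M"
proof (rule ccontr)
  assume x: "x \<notin> M"
  then have "of_nat n * (- x) \<in> M"
    using total M_of_nat_mult by blast
  then have "of_nat n * x = 0"
    using assms(1) M_pointed[of "of_nat n * x"] by simp
  with assms(2) x show False using S_in_M S_closed by simp
qed

lemma M_of_rat_mult:
  assumes x: "x \<in> M" and r: "r \<ge> 0"
  shows "of_rat r * x \<in> M"
proof -
  obtain a b where ab: "b > 0" "r = Fract a b"
    by (metis Rat_cases_nonzero quotient_of_denom_pos quotient_of_div Fract_of_int_quotient prod.exhaust)
  then have a: "a \<ge> 0" using r by (simp add: zero_le_Fract_iff)
  have "of_nat (nat b) * (of_rat r * x) = of_nat (nat a) * x"
    using ab(1) a unfolding ab(2) by (simp add: of_rat_rat)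
  then have "of_nat (nat b) * (of_rat r * x) \<in> M"
    using M_of_nat_mult[OF x, of "nat a"] by (simp only:)
  then show ?thesis
    by (rule M_of_nat_cancel) (use ab(1) in simp)
qed

lemma unit_multiple_in_M_iff: "of_rat r * s \<in> M \<longleftrightarrow> r \<ge> 0"
proof
  assume r: "of_rat r * s \<in> M"
  show "r \<ge> 0"
  proof (rule ccontr)
    assume "\<not> r \<ge> 0"
    then have "of_rat (- r) * s \<in> M" "r \<noteq> 0"
      using M_of_rat_mult[OF S_in_M[OF unit_in], of "- r"] by auto
    then show False
      using M_pointed[OF r] unit_nz by (auto simp: of_rat_minus)
  qed
qed (rule M_of_rat_mult[OF S_in_M[OF unit_in]])

text \<open>
  The supremum in \<open>ratio x\<close> is only meaningful for \<open>x\<close> between two multiples of \<open>s\<close>;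
  elsewhere the set may be empty or unbounded.
\<close>

definition bounded_by_unit :: "complex set" where
  "bounded_by_unit = {x. \<exists>k::nat. of_nat k * s - x \<in> M \<and> of_nat k * s + x \<in> M}"

definition ratio :: "complex \<Rightarrow> real" where
  "ratio x = Sup {of_rat r |r. x - of_rat r * s \<in> M}"

lemma bounded_add:
  assumes "x \<in> bounded_by_unit" "y \<in> bounded_by_unit"
  shows "x + y \<in> bounded_by_unit"
proof -
  obtain k l :: nat where "of_nat k * s - x \<in> M" "of_nat k * s + x \<in> M"
    "of_nat l * s - y \<in> M" "of_nat l * s + y \<in> M"
    using assms by (auto simp: bounded_by_unit_def)
  then have "(of_nat k * s - x) + (of_nat l * s - y) \<in> M" "(of_nat k * s + x) + (of_nat l * s + y) \<in> M"
    by (auto intro: M_add)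
  then have "of_nat (k + l) * s - (x + y) \<in> M \<and> of_nat (k + l) * s + (x + y) \<in> M"
    by (simp add: algebra_simps)
  then show ?thesis unfolding bounded_by_unit_def by blast
qed

lemma bounded_minus: "x \<in> bounded_by_unit \<Longrightarrow> - x \<in> bounded_by_unit"
  by (auto simp: bounded_by_unit_def)

lemma bounded_of_rat_mult:
  assumes x: "x \<in> bounded_by_unit"
  shows "of_rat r * x \<in> bounded_by_unit"
proof -
  have pos: "of_rat r * x \<in> bounded_by_unit" if x: "x \<in> bounded_by_unit" and r: "r \<ge> 0" for r x
  proof -
    obtain k :: nat where k: "of_nat k * s - x \<in> M" "of_nat k * s + x \<in> M"
      using x by (auto simp: bounded_by_unit_def)
    obtain l :: nat where l: "r * of_nat k \<le> of_nat l" 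
      using real_arch_simple by blast
    have "of_rat (of_nat l - r * of_nat k) * s \<in> M"
      using l by (simp add: unit_multiple_in_M_iff)
    then have "of_rat (of_nat l - r * of_nat k) * s + of_rat r * (of_nat k * s - x) \<in> M"
      "of_rat (of_nat l - r * of_nat k) * s + of_rat r * (of_nat k * s + x) \<in> M"
      using k r by (auto intro: M_add M_of_rat_mult)
    then have "of_nat l * s - of_rat r * x \<in> M \<and> of_nat l * s + of_rat r * x \<in> M"
      by (simp add: algebra_simps of_rat_diff of_rat_mult)
    then show ?thesis unfolding bounded_by_unit_def by blast
  qed
  show ?thesis
  proof (cases "r \<ge> 0")
    case False
    then have "of_rat (- r) * (- x) \<in> bounded_by_unit"
      using pos[of "- x" "- r"] bounded_minus[OF x] by simp
    then show ?thesis by (simp add: of_rat_minus)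
  qed (use pos x in blast)
qed

lemma le_ratio:
  assumes x: "x \<in> bounded_by_unit" and r: "x - of_rat r * s \<in> M"
  shows "of_rat r \<le> ratio x"
  unfolding ratio_def
proof (rule cSup_upper)
  obtain k :: nat where k: "of_nat k * s - x \<in> M"
    using x by (auto simp: bounded_by_unit_def)
  have "q \<le> of_nat k" if "x - of_rat q * s \<in> M" for q
  proof -
    have "of_rat (of_nat k - q) * s \<in> M"
      using M_add[OF k that] by (simp add: algebra_simps of_rat_diff)
    then show ?thesis by (simp add: unit_multiple_in_M_iff)
  qed
  then have "of_rat q \<le> (of_rat (of_nat k) :: real)" if "x - of_rat q * s \<in> M" for q
    using that by (simp only: of_rat_less_eq)
  then show "bdd_above {of_rat r :: real |r. x - of_rat r * s \<in> M}"
    by (intro bdd_aboveI[of _ "of_rat (of_nat k)"]) blast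
qed (use r in blast)

lemma ratio_le:
  assumes x: "x \<in> bounded_by_unit" and r: "of_rat r * s - x \<in> M"
  shows "ratio x \<le> of_rat r"
  unfolding ratio_def
proof (rule cSup_least)
  obtain k :: nat where k: "of_nat k * s + x \<in> M"
    using x by (auto simp: bounded_by_unit_def)
  then have "x - of_rat (- of_nat k) * s \<in> M"
    by (simp add: of_rat_minus add.commute)
  then show "{of_rat r |r. x - of_rat r * s \<in> M} \<noteq> ({} :: real set)" by blast
  fix t :: real assume "t \<in> {of_rat r |r. x - of_rat r * s \<in> M}"
  then obtain q where q: "t = of_rat q" "x - of_rat q * s \<in> M" by blast
  have "of_rat (r - q) * s \<in> M"
    using M_add[OF r q(2)] by (simp add: algebra_simps of_rat_diff)
  then show "t \<le> of_rat r" by (simp add: unit_multiple_in_M_iff q of_rat_less_eq)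
qed

text \<open>
  By totality every rational multiple of \<open>s\<close> is comparable with \<open>x\<close>, so \<open>ratio x\<close> is the cut
  separating the multiples below \<open>x\<close> from those above. The converse implications hold up to
  equality only, since \<open>x\<close> may differ from a multiple of \<open>s\<close> by an infinitesimal; this is why the
  identities below are proved by rational approximation.
\<close>

lemma below_if_less_ratio:
  assumes "x \<in> bounded_by_unit" "of_rat r < ratio x"
  shows "x - of_rat r * s \<in> M"
  using ratio_le[OF assms(1), of r] assms(2) total[of "x - of_rat r * s"] by auto

lemma above_if_ratio_less:
  assumes "x \<in> bounded_by_unit" "ratio x < of_rat r"
  shows "of_rat r * s - x \<in> M"
  using le_ratio[OF assms(1), of r] assms(2) total[of "x - of_rat r * s"] by auto

lemma ratio_unit_multiple: "of_rat r * s \<in> bounded_by_unit" "ratio (of_rat r * s) = of_rat r"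
proof -
  have "s \<in> bounded_by_unit"
    unfolding bounded_by_unit_def
    using S_in_M[OF S_closed(1)] S_in_M[OF S_closed(3)[OF unit_in unit_in]]
    by (auto intro!: exI[of _ 1])
  then show b: "of_rat r * s \<in> bounded_by_unit" by (rule bounded_of_rat_mult)
  show "ratio (of_rat r * s) = of_rat r"
    using le_ratio[OF b, of r] ratio_le[OF b, of r] S_in_M S_closed by simp
qed

lemma ratio_minus:
  assumes x: "x \<in> bounded_by_unit"
  shows "ratio (- x) = - ratio x"
proof (rule antisym)
  note mx = bounded_minus[OF x]
  show "ratio (- x) \<le> - ratio x"
  proof (rule ccontr)
    assume "\<not> ?thesis"
    then obtain q where q: "- ratio x < of_rat q" "of_rat q < ratio (- x)"
      using of_rat_dense by (meson not_le)
    have "of_rat (- q) * s - x \<in> M"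
      using below_if_less_ratio[OF mx q(2)] by (simp add: of_rat_minus minus_diff_commute[of x])
    from ratio_le[OF x this] q(1) show False by (simp add: of_rat_minus)
  qed
  show "- ratio x \<le> ratio (- x)"
  proof (rule ccontr)
    assume "\<not> ?thesis"
    then obtain q where q: "ratio (- x) < of_rat q" "of_rat q < - ratio x"
      using of_rat_dense by (meson not_le)
    have "x - of_rat (- q) * s \<in> M"
      using above_if_ratio_less[OF mx q(1)] by (simp add: of_rat_minus algebra_simps)
    from le_ratio[OF x this] q(2) show False by (simp add: of_rat_minus)
  qed
qed

lemma ratio_add:
  assumes x: "x \<in> bounded_by_unit" and y: "y \<in> bounded_by_unit"
  shows "ratio (x + y) = ratio x + ratio y"
proof (rule antisym)
  have upper: "ratio (x + y) \<le> ratio x + ratio y"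
    if x: "x \<in> bounded_by_unit" and y: "y \<in> bounded_by_unit" for x y
  proof (rule field_le_epsilon)
    fix e :: real assume e: "e > 0"
    obtain p where p: "ratio x < of_rat p" "of_rat p < ratio x + e / 2"
      using of_rat_dense[of "ratio x" "ratio x + e / 2"] e by auto
    obtain q where q: "ratio y < of_rat q" "of_rat q < ratio y + e / 2"
      using of_rat_dense[of "ratio y" "ratio y + e / 2"] e by auto
    have "of_rat (p + q) * s - (x + y) \<in> M"
      using M_add[OF above_if_ratio_less[OF x p(1)] above_if_ratio_less[OF y q(1)]]
      by (simp add: of_rat_add algebra_simps)
    from ratio_le[OF bounded_add[OF x y] this] p q
    show "ratio (x + y) \<le> ratio x + ratio y + e" by (simp add: of_rat_add)
  qed
  show "ratio (x + y) \<le> ratio x + ratio y" using upper x y .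
  have "ratio (- (x + y)) \<le> ratio (- x) + ratio (- y)"
    using upper[OF bounded_minus[OF x] bounded_minus[OF y]] by simp
  then show "ratio x + ratio y \<le> ratio (x + y)"
    unfolding ratio_minus[OF x] ratio_minus[OF y] ratio_minus[OF bounded_add[OF x y]] by simp
qed

lemma ratio_diff:
  "x \<in> bounded_by_unit \<Longrightarrow> y \<in> bounded_by_unit \<Longrightarrow> ratio (x - y) = ratio x - ratio y"
  using ratio_add[of x "- y"] bounded_minus ratio_minus by simp

lemma ratio_nonneg:
  assumes "x \<in> bounded_by_unit" "x \<in> M"
  shows "ratio x \<ge> 0"
  using le_ratio[OF assms(1), of 0] assms(2) by simp

lemma ratio_mono:
  assumes "x \<in> bounded_by_unit" "y \<in> bounded_by_unit" "y - x \<in> M"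
  shows "ratio x \<le> ratio y"
  using ratio_nonneg[of "y - x"] ratio_diff assms bounded_add[of y "- x"] bounded_minus by simp

lemma ratio_of_rat_mult:
  assumes x: "x \<in> bounded_by_unit"
  shows "ratio (of_rat r * x) = of_rat r * ratio x"
proof -
  have upper: "ratio (of_rat r * x) \<le> of_rat r * ratio x"
    if x: "x \<in> bounded_by_unit" and r: "r > 0" for r x
  proof (rule ccontr)
    assume "\<not> ?thesis"
    then have "ratio x < ratio (of_rat r * x) / of_rat r"
      using r by (simp add: field_simps)
    then obtain q where q: "ratio x < of_rat q" "of_rat q < ratio (of_rat r * x) / of_rat r"
      using of_rat_dense by blast
    have "of_rat r * (of_rat q * s - x) \<in> M"
      using above_if_ratio_less[OF x q(1)] r by (intro M_of_rat_mult) auto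
    then have "of_rat (r * q) * s - of_rat r * x \<in> M"
      by (simp add: of_rat_mult algebra_simps)
    from ratio_le[OF bounded_of_rat_mult[OF x] this] q(2) r show False
      by (simp add: of_rat_mult field_simps)
  qed
  have pos: "ratio (of_rat r * x) = of_rat r * ratio x" if r: "r > 0" for r
    using upper[OF x r] upper[OF bounded_minus[OF x] r]
      ratio_minus[OF x] ratio_minus[OF bounded_of_rat_mult[OF x, of r]] by simp
  consider "r > 0" | "r = 0" | "r < 0" by linarith
  then show ?thesis
  proof cases
    case 2
    then show ?thesis using ratio_unit_multiple(2)[of 0] by simp
  next
    case 3
    then show ?thesis
      using pos[of "- r"] ratio_minus[OF bounded_of_rat_mult[OF x, of r]] by (simp add: of_rat_minus)
  qed (use pos in blast)
qed

text \<open>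
  Multiplication by \<open>b\<close> preserves the order, so \<open>x \<le> q s\<close> implies \<open>b x \<le> q b s\<close>, and letting \<open>q\<close>
  decrease to \<open>ratio x\<close> gives one inequality; the same bound for \<open>- x\<close> is the other
  inequality, which is why the upper bound is proved for elements of either sign.
\<close>

lemma ratio_mult:
  assumes b: "b \<in> S" and x: "x \<in> bounded_by_unit"
    and bs: "b * s \<in> bounded_by_unit" and bx: "b * x \<in> bounded_by_unit"
  shows "ratio (b * x) = ratio x * ratio (b * s)"
proof -
  have nonneg: "ratio (b * s) \<ge> 0"
    using bs b unit_in by (intro ratio_nonneg S_in_M S_closed)
  have upper: "ratio (b * x) \<le> ratio x * ratio (b * s)"
    if x: "x \<in> bounded_by_unit" and bx: "b * x \<in> bounded_by_unit" for x
  proof -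
    have approx: "ratio (b * x) \<le> of_rat q * ratio (b * s)" if q: "ratio x < of_rat q" for q
    proof -
      have "b * (of_rat q * s - x) \<in> M"
        using above_if_ratio_less[OF x q] b by (intro M_mult)
      then have "of_rat q * (b * s) - b * x \<in> M" by (simp add: algebra_simps)
      from ratio_mono[OF bx bounded_of_rat_mult[OF bs] this] ratio_of_rat_mult[OF bs]
      show ?thesis by simp
    qed
    show ?thesis
    proof (rule ccontr)
      assume less: "\<not> ?thesis"
      \<comment> \<open>If this value were zero, \<open>approx\<close> at any one \<open>q\<close> would already give the claimed bound.\<close>
      have "ratio (b * s) > 0"
        using nonneg approx less by (metis less_eq_real_def mult_zero_right gt_ex of_rat_dense)
      with less have "ratio x < ratio (b * x) / ratio (b * s)"
        by (simp add: field_simps)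
      then obtain q where q: "ratio x < of_rat q" "of_rat q < ratio (b * x) / ratio (b * s)"
        using of_rat_dense by blast
      then show False
        using approx[OF q(1)] \<open>ratio (b * s) > 0\<close> by (simp add: field_simps)
    qed
  qed
  have "ratio (b * (- x)) \<le> ratio (- x) * ratio (b * s)"
    using bounded_minus[OF x] bounded_minus[OF bx] by (intro upper) auto
  then have "ratio x * ratio (b * s) \<le> ratio (b * x)"
    by (simp add: ratio_minus[OF x] ratio_minus[OF bx])
  with upper[OF x bx] show ?thesis by simp
qed

lemma bounded_0: "0 \<in> bounded_by_unit"
  using ratio_unit_multiple(1)[of 0] by simp

lemma ratio_unit: "s \<in> bounded_by_unit" "ratio s = 1"
  using ratio_unit_multiple[of 1] by simp_all

end

section \<open>Injectivity through rational dimension\<close>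

interpretation complex_over_rat: vector_space "\<lambda>(q::rat) (x::complex). of_rat q * x"
  by unfold_locales (simp_all add: algebra_simps of_rat_add of_rat_mult)

text \<open>
  Multiplication by a nonzero \<open>x\<close> is an injective linear map, and an injective linear map of a
  finite-dimensional space into itself is onto: the image of a basis is independent and of full
  size, so no further vector of the span is independent of it.
\<close>

lemma finite_span_subset_mult_image:
  fixes A :: "complex set"
  assumes fin: "finite A" and x: "x \<noteq> 0"
    and xA: "\<And>a. a \<in> A \<Longrightarrow> x * a \<in> complex_over_rat.span A"
  shows "complex_over_rat.span A \<subseteq> complex_over_rat.span ((*) x ` A)"
proof -
  interpret pair: vector_space_pair "\<lambda>(q::rat) (x::complex). of_rat q * x" "\<lambda>(q::rat) (x::complex). of_rat q * x" ..
  have lin: "Vector_Spaces.linear (\<lambda>(q::rat) (x::complex). of_rat q * x) (\<lambda>(q::rat) (x::complex). of_rat q * x) ((*) x)"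
    by unfold_locales (simp_all add: algebra_simps)
  obtain B where B: "B \<subseteq> A" "complex_over_rat.independent B" "A \<subseteq> complex_over_rat.span B"
    by (rule complex_over_rat.maximal_independent_subset)
  have finB: "finite B" using B(1) fin finite_subset by blast
  have spanB: "complex_over_rat.span A = complex_over_rat.span B"
    using B complex_over_rat.span_mono complex_over_rat.span_minimal complex_over_rat.subspace_span
    by (metis subset_antisym)
  have inj: "inj_on ((*) x) X" for X using x by (auto simp: inj_on_def)
  have indep: "complex_over_rat.independent ((*) x ` B)"
    using pair.linear_independent_injective_image[OF lin B(2) inj] .
  have cardB: "card ((*) x ` B) = card B" using inj by (rule card_image)
  have sub: "complex_over_rat.span A \<subseteq> complex_over_rat.span ((*) x ` B)"
  proof
    fix y assume y: "y \<in> complex_over_rat.span A"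
    show "y \<in> complex_over_rat.span ((*) x ` B)"
    proof (rule ccontr)
      assume ny: "y \<notin> complex_over_rat.span ((*) x ` B)"
      have "insert y ((*) x ` B) \<subseteq> complex_over_rat.span B"
        using y xA B(1) spanB by auto
      then have "card (insert y ((*) x ` B)) \<le> card B"
        using complex_over_rat.independent_span_bound[OF finB]
          complex_over_rat.independent_insertI[OF ny indep] by blast
      moreover have "y \<notin> (*) x ` B"
        using ny complex_over_rat.span_base by blast
      ultimately show False using cardB finB by simp
    qed
  qed
  also have "\<dots> \<subseteq> complex_over_rat.span ((*) x ` A)"
    using B(1) by (intro complex_over_rat.span_mono) auto
  finally show ?thesis .
qed

section \<open>Finitely generated pointed semidomains\<close>

context total_cone
begin

text \<open>
  The kernel of \<open>ratio\<close> is a rational subspace. If it contains a nonzero difference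
  \<open>x = p - q\<close> of elements of \<open>S\<close>, it contains \<open>x A\<close> by \<open>ratio_mult\<close>, hence the whole span of \<open>A\<close>, and in
  particular \<open>s\<close>.
\<close>

lemma ratio_inj_on:
  assumes bdd: "S \<subseteq> bounded_by_unit"
    and A: "finite A" "A \<subseteq> S" "S \<subseteq> complex_over_rat.span A"
  shows "inj_on ratio S"
proof (rule inj_onI)
  fix p q assume pq: "p \<in> S" "q \<in> S" "ratio p = ratio q"
  define x where "x = p - q"
  let ?K = "{y \<in> bounded_by_unit. ratio y = 0}"
  have subspace: "complex_over_rat.subspace ?K"
    unfolding complex_over_rat.subspace_def
    using bounded_0 ratio_unit_multiple(2)[of 0]
    by (auto simp: bounded_add ratio_add bounded_of_rat_mult ratio_of_rat_mult)
  have "(*) x ` A \<subseteq> ?K"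
  proof safe
    fix a assume "a \<in> A"
    then have a: "a \<in> S" using A by blast
    have mem: "a * p \<in> bounded_by_unit" "a * q \<in> bounded_by_unit" "a * s \<in> bounded_by_unit"
      using a pq S_closed(4) bdd unit_in by blast+
    have "x * a = a * p + - (a * q)"
      by (simp add: x_def algebra_simps)
    then show "x * a \<in> bounded_by_unit"
      using bounded_add[OF mem(1) bounded_minus[OF mem(2)]] by simp
    have "ratio (a * p) = ratio (a * q)"
      using ratio_mult[OF a, of p] ratio_mult[OF a, of q] pq mem subsetD[OF bdd] by simp
    then show "ratio (x * a) = 0"
      using \<open>x * a = a * p + - (a * q)\<close> ratio_diff[OF mem(1,2)] by simp
  qed
  then have zero: "complex_over_rat.span ((*) x ` A) \<subseteq> ?K"
    using subspace by (rule complex_over_rat.span_minimal)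
  have "x = 0"
  proof (rule ccontr)
    assume "x \<noteq> 0"
    have "x * a \<in> complex_over_rat.span A" if "a \<in> A" for a
    proof -
      have "p * a \<in> complex_over_rat.span A" "q * a \<in> complex_over_rat.span A"
        using that A pq S_closed(4) by blast+
      then show ?thesis
        using complex_over_rat.span_diff by (simp add: x_def left_diff_distrib)
    qed
    from finite_span_subset_mult_image[OF A(1) \<open>x \<noteq> 0\<close> this] have "s \<in> ?K"
      using zero A(3) unit_in by blast
    then show False using ratio_unit by simp
  qed
  then show "p = q" by (simp add: x_def)
qed

text \<open>
  Taking \<open>x = 1\<close> in \<open>ratio_mult\<close> gives \<open>ratio b = ratio 1 * ratio (b s)\<close>, so dividing by \<open>ratio 1\<close>
  turns \<open>ratio\<close> into a multiplicative map. The divisor is nonzero because \<open>b = s\<close> makes the left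
  side equal to \<open>1\<close>.
\<close>

lemma isomorphic_positive_semidomain:
  assumes bdd: "S \<subseteq> bounded_by_unit" and inj: "inj_on ratio S"
  shows "\<exists>T. positive_semidomain T \<and> semiring_isomorphic S T"
proof -
  define h where "h x = complex_of_real (ratio x / ratio 1)" for x
  have mult: "ratio (b * x) = ratio x * ratio (b * s)" if "b \<in> S" "x \<in> S" for b x
    using that bdd S_closed(4) unit_in by (intro ratio_mult) auto
  have one: "ratio 1 \<noteq> 0"
    using mult[OF unit_in S_closed(2)] ratio_unit by auto
  have nonneg: "ratio x \<ge> 0" if "x \<in> S" for x
    using that bdd S_in_M by (intro ratio_nonneg) auto
  have h0: "h 0 = 0" and h1: "h 1 = 1"
    using one ratio_unit_multiple(2)[of 0] by (simp_all add: h_def)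
  have hadd: "h (x + y) = h x + h y" if "x \<in> S" "y \<in> S" for x y
  proof -
    have "ratio (x + y) = ratio x + ratio y" using that bdd by (intro ratio_add) auto
    then show ?thesis by (simp add: h_def add_divide_distrib)
  qed
  have hmult: "h (x * y) = h x * h y" if "x \<in> S" "y \<in> S" for x y
    using mult[OF that] mult[OF that(1) S_closed(2)] one by (simp add: h_def)
  have hinj: "inj_on h S"
    using inj one by (auto simp: h_def inj_on_def)
  have "complex_semidomain (h ` S)"
    unfolding complex_semidomain_def
    using h0 h1 S_closed hadd hmult by (auto simp: image_iff) (metis+)
  moreover have "h ` S \<subseteq> \<real>\<^sub>\<ge>\<^sub>0"
    using nonneg S_closed(2) by (auto simp: h_def)
  moreover have "h \<in> ring_iso (semiring_on S) (semiring_on (h ` S))"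
    using hadd hmult h1 hinj
    by (auto simp: ring_iso_def ring_hom_def semiring_on_def bij_betw_def)
  ultimately show ?thesis
    using h0 unfolding positive_semidomain_def semiring_isomorphic_def by blast
qed

end

text \<open>
  The sum of the generators dominates every element of \<open>S\<close>: if \<open>x\<close> has coefficients \<open>f a\<close>, then
  \<open>k s - x\<close> has coefficients \<open>k - f a\<close>, which are nonnegative for \<open>k = \<Sum>a\<in>A. f a\<close>.
\<close>

theorem finitely_generated_pointed_semidomain_isomorphic_positive:
  assumes S: "complex_semidomain S" and pointed: "\<And>x. x \<in> S \<Longrightarrow> - x \<in> S \<Longrightarrow> x = 0"
    and A: "finite A" "A \<subseteq> S"
    and gen: "\<And>x. x \<in> S \<Longrightarrow> \<exists>f::complex \<Rightarrow> nat. x = (\<Sum>a\<in>A. of_nat (f a) * a)"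
  shows "\<exists>T. positive_semidomain T \<and> semiring_isomorphic S T"
proof -
  have S0: "0 \<in> S" and S1: "1 \<in> S"
    and Sadd: "\<And>x y. x \<in> S \<Longrightarrow> y \<in> S \<Longrightarrow> x + y \<in> S"
    using S by (auto simp: complex_semidomain_def)
  have Snat: "of_nat n * x \<in> S" if "x \<in> S" for n x
    by (induction n) (auto simp: S0 Sadd that distrib_right)
  have Ssum: "(\<Sum>a\<in>A. of_nat (f a) * a) \<in> S" for f
    using A by (induction A rule: finite_induct) (auto simp: S0 Sadd Snat)
  define s where "s = \<Sum>A"
  have s: "s \<in> S" using Ssum[of "\<lambda>_. 1"] by (simp add: s_def)
  have dominated: "\<exists>k::nat. of_nat k * s - x \<in> S" if "x \<in> S" for x
  proof -
    obtain f :: "complex \<Rightarrow> nat" where f: "x = (\<Sum>a\<in>A. of_nat (f a) * a)" using gen[OF \<open>x \<in> S\<close>] by blast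
    have le: "f a \<le> sum f A" if "a \<in> A" for a
      using that A(1) by (simp add: member_le_sum)
    have "of_nat (sum f A) * s - x = (\<Sum>a\<in>A. of_nat (sum f A) * a - of_nat (f a) * a)"
      by (simp only: f s_def sum_distrib_left sum_subtractf)
    also have "\<dots> = (\<Sum>a\<in>A. of_nat (sum f A - f a) * a)"
      using le by (intro sum.cong) (auto simp: of_nat_diff left_diff_distrib)
    finally show ?thesis using Ssum by metis
  qed
  \<comment> \<open>If \<open>s\<close> were zero, domination of \<open>1\<close> would put \<open>- 1\<close> into \<open>S\<close>.\<close>
  have "s \<noteq> 0"
    using dominated[OF S1] pointed[OF S1] by auto
  obtain M where M: "pointed_cone_over S M" "\<And>x. x \<in> M \<or> - x \<in> M"
    using total_cone_exists[OF S pointed] by blast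
  interpret total_cone S M s
    by unfold_locales (use S M s \<open>s \<noteq> 0\<close> in auto)
  have bdd: "S \<subseteq> bounded_by_unit"
  proof
    fix x assume x: "x \<in> S"
    obtain k :: nat where "of_nat k * s - x \<in> S" using dominated[OF x] by blast
    moreover have "of_nat k * s + x \<in> S" using Snat s x Sadd by blast
    ultimately show "x \<in> bounded_by_unit"
      unfolding bounded_by_unit_def using S_in_M by blast
  qed
  have "S \<subseteq> complex_over_rat.span A"
  proof
    fix x assume "x \<in> S"
    then obtain f :: "complex \<Rightarrow> nat" where f: "x = (\<Sum>a\<in>A. of_nat (f a) * a)" using gen by blast
    have "of_nat (f a) * a \<in> complex_over_rat.span A" if "a \<in> A" for a
      using complex_over_rat.span_scale[OF complex_over_rat.span_base[OF that], of "of_nat (f a)"] by simp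
    then show "x \<in> complex_over_rat.span A"
      unfolding f by (rule complex_over_rat.span_sum)
  qed
  with bdd A show ?thesis
    by (intro isomorphic_positive_semidomain ratio_inj_on)
qed

section \<open>Additive atoms\<close>

lemma sum_list_eq_sum_count:
  fixes xs :: "'a::semiring_1 list"
  assumes "finite A" "set xs \<subseteq> A"
  shows "sum_list xs = (\<Sum>a\<in>A. of_nat (count_list xs a) * a)"
  using assms(2)
proof (induction xs)
  case (Cons x xs)
  have "(\<Sum>a\<in>A. of_nat (count_list (x # xs) a) * a) =
      (\<Sum>a\<in>A. (if a = x then x else 0) + of_nat (count_list xs a) * a)"
    by (intro sum.cong) (auto simp: distrib_right)
  then show ?case
    using Cons assms(1) by (simp add: sum.distrib)
qed simp

lemma semiring_on_simps [simp]:
  "carrier (semiring_on S) = S"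
  "zero (semiring_on S) = 0" "one (semiring_on S) = 1"
  "add (semiring_on S) = (+)" "mult (semiring_on S) = (*)"
  by (simp_all add: semiring_on_def)

lemma comm_monoid_cancel_add:
  assumes "complex_semidomain S"
  shows "comm_monoid_cancel (add_monoid (semiring_on S))"
  using assms by unfold_locales (auto simp: complex_semidomain_def algebra_simps)

lemma Units_add_monoid: "Units (add_monoid (semiring_on S)) = {x \<in> S. - x \<in> S}"
proof -
  have "(\<exists>y\<in>S. y + x = 0 \<and> x + y = 0) \<longleftrightarrow> - x \<in> S" for x
    by (metis add.right_inverse add.left_inverse add_eq_0_iff)
  then show ?thesis unfolding Units_def by auto
qed

lemma additive_atoms_iff:
  assumes S: "complex_semidomain S"
  shows "a \<in> additive_atoms S \<longleftrightarrow>
    a \<in> S \<and> - a \<notin> S \<and> (\<forall>x\<in>S. \<forall>y\<in>S. a = x + y \<longrightarrow> - x \<in> S \<or> - y \<in> S)"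
  using comm_monoid_cancel.irreducible_iff_atom[OF comm_monoid_cancel_add[OF S], of a,
      unfolded Units_add_monoid]
  by (auto simp: additive_atoms_def)

lemma additive_atoms_add_unit:
  assumes S: "complex_semidomain S" and a: "a \<in> additive_atoms S" and u: "u \<in> S" "- u \<in> S"
  shows "a + u \<in> additive_atoms S"
proof -
  have add: "x + y \<in> S" if "x \<in> S" "y \<in> S" for x y
    using S that by (auto simp: complex_semidomain_def)
  have aS: "a \<in> S" and na: "- a \<notin> S"
    and split: "\<And>x y. x \<in> S \<Longrightarrow> y \<in> S \<Longrightarrow> a = x + y \<Longrightarrow> - x \<in> S \<or> - y \<in> S"
    using a unfolding additive_atoms_iff[OF S] by blast+
  show ?thesis
    unfolding additive_atoms_iff[OF S]
  proof (intro conjI ballI impI notI)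
    show "a + u \<in> S" using aS u add by blast
    show False if "- (a + u) \<in> S"
      using add[OF that u(1)] na by simp
    fix x y assume xy: "x \<in> S" "y \<in> S" "a + u = x + y"
    have "a = (x + - u) + y" using xy(3) by (simp add: algebra_simps)
    then have "- (x + - u) \<in> S \<or> - y \<in> S"
      using split[of "x + - u" y] add[OF xy(1) u(2)] xy(2) by blast
    then show "- x \<in> S \<or> - y \<in> S"
      using add[of "- (x + - u)" "- u"] u(2) by auto
  qed
qed

text \<open>
  In characteristic zero a nonzero additive unit has infinitely many multiples, and they translate
  one atom to infinitely many others.
\<close>

lemma additive_atoms_empty_if_unit:
  assumes S: "complex_semidomain S" and fin: "finite (additive_atoms S)"
    and u: "u \<in> S" "- u \<in> S" "u \<noteq> 0"
  shows "additive_atoms S = {}"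
proof (rule ccontr)
  assume "additive_atoms S \<noteq> {}"
  then obtain a where a: "a \<in> additive_atoms S" by blast
  have "a + of_nat n * u \<in> additive_atoms S" for n
  proof (induction n)
    case (Suc n)
    from additive_atoms_add_unit[OF S this u(1,2)] show ?case by (simp add: algebra_simps)
  qed (use a in simp)
  then have "range (\<lambda>n::nat. a + of_nat n * u) \<subseteq> additive_atoms S" by blast
  moreover have "inj (\<lambda>n::nat. a + of_nat n * u)"
    using u(3) by (auto simp: inj_on_def)
  ultimately show False
    using fin finite_subset range_inj_infinite by blast
qed

lemma factorial_sum_of_additive_atoms:
  assumes "factorial_monoid (add_monoid (semiring_on S))" and "x \<in> S" "- x \<notin> S"
  obtains xs where "set xs \<subseteq> additive_atoms S" "x = sum_list xs"
proof -
  obtain xs where xs: "set xs \<subseteq> S" "factors (add_monoid (semiring_on S)) xs x"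
    using factorial_monoid.factors_exist[OF assms(1), of x, unfolded Units_add_monoid] assms(2,3)
    by auto
  then have "set xs \<subseteq> additive_atoms S" "x = sum_list xs"
    by (auto simp: factors_def additive_atoms_def sum_list.eq_foldr)
  then show thesis by (rule that)
qed

lemma is_UFD_if_closed_under_minus:
  assumes S: "complex_semidomain S" and neg: "\<And>x. x \<in> S \<Longrightarrow> - x \<in> S"
    and fact: "factorial_monoid (mult_of (semiring_on S))"
  shows "is_UFD S"
proof -
  interpret semiring "semiring_on S" using S by (rule semiring_semiring_on)
  have "domain (semiring_on S)"
  proof (intro domain.intro cring.intro ring.intro)
    show "abelian_group (semiring_on S)"
      using S neg
      by (intro abelian_groupI)
        (auto simp: complex_semidomain_def algebra_simps intro: bexI[of _ "- _"])
    show "comm_monoid (semiring_on S)"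
      by unfold_locales auto
    then show "domain_axioms (semiring_on S)"
      by unfold_locales auto
  qed (unfold_locales; auto simp: algebra_simps)+
  then show ?thesis
    using fact by (simp add: is_UFD_def factorial_domain_def)
qed

theorem theorem6p1:
  fixes S :: "complex set"
  assumes "complex_semidomain S"
    and "bi_UFS S"
    and "\<not> is_UFD S"
    and "finite (additive_atoms S)"
  shows "\<exists>T. positive_semidomain T \<and> semiring_isomorphic S T"
proof -
  note S = assms(1)
  have fadd: "factorial_monoid (add_monoid (semiring_on S))"
    and fmult: "factorial_monoid (mult_of (semiring_on S))"
    using assms(2) by (auto simp: bi_UFS_def)
  have pointed: "x = 0" if "x \<in> S" "- x \<in> S" for x
  proof (rule ccontr)
    assume "x \<noteq> 0"
    then have empty: "additive_atoms S = {}"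
      using additive_atoms_empty_if_unit S assms(4) that by blast
    have "- y \<in> S" if "y \<in> S" for y
    proof (rule ccontr)
      assume ny: "- y \<notin> S"
      obtain xs where "set xs \<subseteq> additive_atoms S" "y = sum_list xs"
        using factorial_sum_of_additive_atoms[OF fadd \<open>y \<in> S\<close> ny] by blast
      then show False using empty ny that by simp
    qed
    then show False
      using is_UFD_if_closed_under_minus[OF S _ fmult] assms(3) by blast
  qed
  show ?thesis
  proof (rule finitely_generated_pointed_semidomain_isomorphic_positive[OF S pointed assms(4)])
    show "additive_atoms S \<subseteq> S" by (auto simp: additive_atoms_def)
    show "\<exists>f::complex \<Rightarrow> nat. x = (\<Sum>a\<in>additive_atoms S. of_nat (f a) * a)" if x: "x \<in> S" for x
    proof (cases "- x \<in> S")
      case True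
      with x pointed have "x = 0" by blast
      then show ?thesis by (auto intro!: exI[of _ "\<lambda>_. 0"])
    next
      case False
      obtain xs where xs: "set xs \<subseteq> additive_atoms S" "x = sum_list xs"
        using factorial_sum_of_additive_atoms[OF fadd x False] by blast
      have "x = (\<Sum>a\<in>additive_atoms S. of_nat (count_list xs a) * a)"
        using sum_list_eq_sum_count[OF assms(4) xs(1)] xs(2) by simp
      then show ?thesis by (intro exI[of _ "count_list xs"])
    qed
  qed
qed

end
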